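(* Let $f$ be a smooth function, $r_0>0$, $J$ an open interval, and $a:J\to(0,\infty)$ smooth with $1-r_0\dot a\neq0$ on $J$. Let $\mathcal{R},\mathcal{T}:J\to\mathbb{R}$ satisfy (M1), (M2) below, with $\mathcal{T}$ invertible on $J$ onto its image. Assume that $f_{,R}$ is locally invertible along the matching hypersurface $\Sigma$, in the sense that there is an open interval $O\supset R_-(J)$ on which $f_{,R}$ is injective, with inverse $\Phi=(f_{,R}|_O)^{-1}$, and that $f_{,RR}(R_-(t))\neq0$ for all $t\in J$. Then the matching conditions determine the exterior solution uniquely over $\mathcal{T}(J)$. That is, if $M_1$ and $M_2$ are smooth mass functions on a common domain $U=\{(v,r_v):v=\mathcal{T}(t),\ t\in J,\ \mathcal{R}(t)\le r_v<r_{\max}(v)\}$ (for some function $r_{\max}$ with $r_{\max}(\mathcal{T}(t))>\mathcal{R}(t)$), such that for each $i=1,2$ the generalized Vaidya metric with mass function $M_i$ has Ricci scalar with values in $O$, solves the metric $f(R)$ field equations with an energy-momentum tensor of generalized Vaidya form, and satisfies the matching conditions (M3)--(M6) with the spatially flat FLRW interior of scale factor $a$, then $M_1=M_2$ on $U$.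
   Context: The interior metric is $ds_-^2=-dt^2+a^2(t)(dr^2+r^2d\Omega^2)$, with Ricci scalar $R_-(t)=6\left(\frac{\ddot a}{a}+\frac{\dot a^2}{a^2}\right)$. The exterior (generalized Vaidya) metric is $ds_+^2=-\left(1-\frac{2M(v,r_v)}{r_v}\right)dv^2+2\,dv\,dr_v+r_v^2d\Omega^2$, with Ricci scalar $R_+(v,r_v)=\frac{2}{r_v^2}\left(r_vM_{,r_vr_v}+2M_{,r_v}\right)$. The metric $f(R)$ field equations are $$f_{,R}R_{\mu\nu}-\tfrac12 f(R)g_{\mu\nu}+(g_{\mu\nu}\Box-\nabla_\mu\nabla_\nu)f_{,R}=\kappa T_{\mu\nu},$$ with $f_{,R}=df/dR$, $f_{,RR}=d^2f/dR^2$. An energy-momentum tensor of generalized Vaidya form is $T_{\mu\nu}=\mu\,l_\mu l_\nu+(\rho+p)(l_\mu n_\nu+l_\nu n_\mu)+p\,g_{\mu\nu}$ for some functions $\mu,\rho,p$, where in coordinates $(v,r_v,\theta,\varphi)$, $l_\mu=\delta^0_\mu$ and $n_\mu=\frac12\left(1-\frac{2M}{r_v}\right)\delta^0_\mu-\delta^1_\mu$. The matching hypersurface $\Sigma$ is $r=r_0$ from the interior and $v=\mathcal{T}(t)$, $r_v=\mathcal{R}(t)$ from the exterior. The matching conditions (continuity of the induced metric, extrinsic curvature, Ricci scalar and its normal derivative), for all $t\in J$, are: (M1) $\mathcal{R}(t)=r_0a(t)$; (M2) $\dot{\mathcal{T}}(t)=\frac{1}{1-r_0\dot a(t)}$; (M3)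 $M(\mathcal{T}(t),\mathcal{R}(t))=\frac{r_0^3}{2}a\dot a^2$; (M4) $M_{,r_v}(\mathcal{T}(t),\mathcal{R}(t))=r_0^2\left(\frac12\dot a^2+a\ddot a\right)$; (M5) $R_+(\mathcal{T}(t),\mathcal{R}(t))=R_-(t)$; (M6) $\left[\partial_vR_++(1-\dot{\mathcal{R}}(t))\,\partial_{r_v}R_+\right](\mathcal{T}(t),\mathcal{R}(t))=0$. *)

theory Defs
  imports "HOL-Analysis.Analysis"
begin

subsection \<open>Smooth functions\<close>

primrec Ck_on :: "nat \<Rightarrow> 'a::real_normed_vector set \<Rightarrow> ('a \<Rightarrow> real) \<Rightarrow> bool" where
  "Ck_on 0 W F \<longleftrightarrow> continuous_on W F"
| "Ck_on (Suc k) W F \<longleftrightarrow> (\<forall>x\<in>W. F differentiable (at x)) \<and>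
     (\<forall>h. Ck_on k W (\<lambda>x. frechet_derivative F (at x) h))"

text \<open>
  On a set that need not be open (such as an exterior region including its boundary
  hypersurface), smoothness means smoothness on some open neighbourhood of the set.
\<close>

definition smooth_on :: "'a::real_normed_vector set \<Rightarrow> ('a \<Rightarrow> real) \<Rightarrow> bool" where
  "smooth_on S F \<longleftrightarrow> (\<exists>W. open W \<and> S \<subseteq> W \<and> (\<forall>k. Ck_on k W F))"

subsection \<open>Curvature of a metric in one coordinate chart\<close>

text \<open>
  Coordinates are points of \<open>real ^ 4\<close>; the indices \<open>1, 2, 3, 4\<close> stand for the
  spacetime indices that are usually written \<open>0, 1, 2, 3\<close>.
\<close>

type_synonym event = "real ^ 4"
type_synonym tensor2 = "event \<Rightarrow> real ^ 4 ^ 4"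

definition pd :: "4 \<Rightarrow> (event \<Rightarrow> real) \<Rightarrow> event \<Rightarrow> real" where
  "pd i F x = deriv (\<lambda>h. F (x + h *\<^sub>R axis i 1)) 0"

definition inv_metric :: "tensor2 \<Rightarrow> tensor2" where
  "inv_metric g x = matrix_inv (g x)"

text \<open>\<open>christoffel g l m n\<close> has \<open>l\<close> as its upper index.\<close>

definition christoffel :: "tensor2 \<Rightarrow> 4 \<Rightarrow> 4 \<Rightarrow> 4 \<Rightarrow> event \<Rightarrow> real" where
  "christoffel g l m n x = 1 / 2 * (\<Sum>s\<in>UNIV. inv_metric g x $ l $ s *
     (pd m (\<lambda>y. g y $ s $ n) x + pd n (\<lambda>y. g y $ s $ m) x - pd s (\<lambda>y. g y $ m $ n) x))"

definition ricci :: "tensor2 \<Rightarrow> tensor2" where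
  "ricci g x = (\<chi> m n.
     (\<Sum>l\<in>UNIV. pd l (christoffel g l m n) x) - (\<Sum>l\<in>UNIV. pd n (christoffel g l m l) x)
     + (\<Sum>l\<in>UNIV. \<Sum>s\<in>UNIV. christoffel g l l s x * christoffel g s m n x)
     - (\<Sum>l\<in>UNIV. \<Sum>s\<in>UNIV. christoffel g l n s x * christoffel g s m l x))"

definition trace_metric :: "tensor2 \<Rightarrow> tensor2 \<Rightarrow> event \<Rightarrow> real" where
  "trace_metric g A x = (\<Sum>m\<in>UNIV. \<Sum>n\<in>UNIV. inv_metric g x $ m $ n * A x $ m $ n)"

definition ricci_scalar :: "tensor2 \<Rightarrow> event \<Rightarrow> real" where
  "ricci_scalar g = trace_metric g (ricci g)"

definition cov_hessian :: "tensor2 \<Rightarrow> (event \<Rightarrow> real) \<Rightarrow> tensor2" where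
  "cov_hessian g F x = (\<chi> m n.
     pd m (pd n F) x - (\<Sum>s\<in>UNIV. christoffel g s m n x * pd s F x))"

definition dalembertian :: "tensor2 \<Rightarrow> (event \<Rightarrow> real) \<Rightarrow> event \<Rightarrow> real" where
  "dalembertian g F = trace_metric g (cov_hessian g F)"

definition fR_field_equations ::
  "(real \<Rightarrow> real) \<Rightarrow> real \<Rightarrow> tensor2 \<Rightarrow> tensor2 \<Rightarrow> event set \<Rightarrow> bool" where
  "fR_field_equations f \<kappa> g T S \<longleftrightarrow>
     (let R = ricci_scalar g; fR = (\<lambda>x. deriv f (R x)) in
      \<forall>x\<in>S. \<forall>m n.
        fR x * ricci g x $ m $ n - 1 / 2 * f (R x) * g x $ m $ n
        + (g x $ m $ n * dalembertian g fR x - cov_hessian g fR x $ m $ n)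
        = \<kappa> * T x $ m $ n)"

subsection \<open>Generalized Vaidya spacetimes\<close>

text \<open>
  The coordinates are \<open>(v, r, \<theta>, \<phi>) = (x $ 1, x $ 2, x $ 3, x $ 4)\<close>;
  a mass function takes the pair \<open>(v, r)\<close>.
\<close>

definition vaidya_metric :: "(real \<times> real \<Rightarrow> real) \<Rightarrow> tensor2" where
  "vaidya_metric M x = (let v = x $ 1; r = x $ 2; \<theta> = x $ 3 in
     vector [vector [- (1 - 2 * M (v, r) / r), 1, 0, 0],
             vector [1, 0, 0, 0],
             vector [0, 0, r\<^sup>2, 0],
             vector [0, 0, 0, r\<^sup>2 * (sin \<theta>)\<^sup>2]])"

definition vaidya_l :: "event \<Rightarrow> real ^ 4" where
  "vaidya_l x = axis 1 1"

definition vaidya_n :: "(real \<times> real \<Rightarrow> real) \<Rightarrow> event \<Rightarrow> real ^ 4" where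
  "vaidya_n M x = (1 / 2 * (1 - 2 * M (x $ 1, x $ 2) / x $ 2)) *\<^sub>R axis 1 1 - axis 2 1"

definition vaidya_stress ::
  "(real \<times> real \<Rightarrow> real) \<Rightarrow> (event \<Rightarrow> real) \<Rightarrow> (event \<Rightarrow> real) \<Rightarrow> (event \<Rightarrow> real) \<Rightarrow> tensor2" where
  "vaidya_stress M \<mu> \<rho> p x = (\<chi> i j.
     \<mu> x * vaidya_l x $ i * vaidya_l x $ j
     + (\<rho> x + p x) * (vaidya_l x $ i * vaidya_n M x $ j + vaidya_l x $ j * vaidya_n M x $ i)
     + p x * vaidya_metric M x $ i $ j)"

text \<open>The metric degenerates on the axis \<open>sin \<theta> = 0\<close>, which the chart omits.\<close>

definition exterior_events :: "(real \<times> real) set \<Rightarrow> event set" where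
  "exterior_events U = {x. (x $ 1, x $ 2) \<in> U \<and> 0 < x $ 3 \<and> x $ 3 < pi}"

definition solves_fR_vaidya ::
  "(real \<Rightarrow> real) \<Rightarrow> real \<Rightarrow> (real \<times> real) set \<Rightarrow> (real \<times> real \<Rightarrow> real) \<Rightarrow> bool" where
  "solves_fR_vaidya f \<kappa> U M \<longleftrightarrow> (\<exists>\<mu> \<rho> p.
     fR_field_equations f \<kappa> (vaidya_metric M) (vaidya_stress M \<mu> \<rho> p) (exterior_events U))"

definition exterior_region ::
  "real set \<Rightarrow> (real \<Rightarrow> real) \<Rightarrow> (real \<Rightarrow> real) \<Rightarrow> (real \<Rightarrow> ereal) \<Rightarrow> (real \<times> real) set" where
  "exterior_region J \<T> \<R> rmax =
     {(v, r). \<exists>t\<in>J. v = \<T> t \<and> \<R> t \<le> r \<and> ereal r < rmax v}"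

subsection \<open>Matching to a spatially flat FLRW interior\<close>

definition d_v :: "(real \<times> real \<Rightarrow> real) \<Rightarrow> real \<times> real \<Rightarrow> real" where
  "d_v F = (\<lambda>(v, r). deriv (\<lambda>s. F (s, r)) v)"

definition d_r :: "(real \<times> real \<Rightarrow> real) \<Rightarrow> real \<times> real \<Rightarrow> real" where
  "d_r F = (\<lambda>(v, r). deriv (\<lambda>s. F (v, s)) r)"

text \<open>Ricci scalar of \<open>-dt\<^sup>2 + a\<^sup>2 (dr\<^sup>2 + r\<^sup>2 d\<Omega>\<^sup>2)\<close>:\<close>

definition R_minus :: "(real \<Rightarrow> real) \<Rightarrow> real \<Rightarrow> real" where
  "R_minus a t = 6 * (deriv (deriv a) t / a t + (deriv a t)\<^sup>2 / (a t)\<^sup>2)"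

text \<open>Closed form of \<open>ricci_scalar (vaidya_metric M)\<close> as a function of \<open>(v, r)\<close>:\<close>

definition R_plus :: "(real \<times> real \<Rightarrow> real) \<Rightarrow> real \<times> real \<Rightarrow> real" where
  "R_plus M = (\<lambda>(v, r). 2 / r\<^sup>2 * (r * d_r (d_r M) (v, r) + 2 * d_r M (v, r)))"

text \<open>
  The conditions on the exterior mass function: those on \<open>M\<close> and \<open>M\<^sub>,\<^sub>r\<close> come from the
  extrinsic curvature, the last two from the Ricci scalar and its normal derivative.
\<close>

definition matches_flrw ::
  "real \<Rightarrow> (real \<Rightarrow> real) \<Rightarrow> real set \<Rightarrow> (real \<Rightarrow> real) \<Rightarrow> (real \<Rightarrow> real) \<Rightarrow>
   (real \<times> real \<Rightarrow> real) \<Rightarrow> bool" where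
  "matches_flrw r0 a J \<T> \<R> M \<longleftrightarrow> (\<forall>t\<in>J.
     M (\<T> t, \<R> t) = r0 ^ 3 / 2 * a t * (deriv a t)\<^sup>2 \<and>
     d_r M (\<T> t, \<R> t) = r0\<^sup>2 * (1 / 2 * (deriv a t)\<^sup>2 + a t * deriv (deriv a) t) \<and>
     R_plus M (\<T> t, \<R> t) = R_minus a t \<and>
     d_v (R_plus M) (\<T> t, \<R> t) + (1 - deriv \<R> t) * d_r (R_plus M) (\<T> t, \<R> t) = 0)"

end

theory Submission
  imports Defs
begin

text \<open>
  In a generalized Vaidya metric \<open>g\<^sub>r\<^sub>r\<close>, \<open>R\<^sub>r\<^sub>r\<close>, all \<open>\<Gamma>\<^sup>s\<^sub>r\<^sub>r\<close> and the \<open>rr\<close>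
  component of the stress tensor vanish, so the \<open>rr\<close> field equation says
  \<open>\<partial>\<^sub>r\<^sup>2 f\<^sub>,\<^sub>R = 0\<close>: along each line of constant \<open>v\<close>, \<open>f\<^sub>,\<^sub>R\<close> is affine in \<open>r\<close>.
  The value of \<open>R\<^sub>+\<close> on \<open>\<Sigma>\<close> is prescribed by (M5); differentiating (M5) along \<open>\<Sigma>\<close> and
  combining the result with (M6) prescribes \<open>\<partial>\<^sub>r R\<^sub>+\<close> there as well. Hence both solutions have
  the same \<open>f\<^sub>,\<^sub>R\<close>, and by injectivity the same \<open>R\<^sub>+\<close>. The equation for \<open>M\<close> with given
  \<open>R\<^sub>+\<close> is linear, and the difference of two solutions satisfies \<open>\<partial>\<^sub>r (r\<^sup>2 \<partial>\<^sub>r M) = 0\<close> with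
  zero initial data by (M3) and (M4).
\<close>

subsection \<open>Partial derivatives of smooth functions\<close>

text \<open>On an open set, a derivative at a point depends only on nearby values. This lets
  \<open>Ck_on\<close> pass between Frechet derivatives and partial derivatives, which are known to
  agree only on \<open>W\<close>.\<close>

lemma Ck_on_cong:
  assumes "open W" "\<And>x. x \<in> W \<Longrightarrow> F x = G x" "Ck_on k W F"
  shows "Ck_on k W G"
  using assms(2,3)
proof (induction k arbitrary: F G)
  case 0
  have "continuous_on W F = continuous_on W G"
    by (rule continuous_on_cong) (use 0 in auto)
  with 0 show ?case by simp
next
  case (Suc k)
  have dG: "(G has_derivative frechet_derivative F (at x)) (at x)" if "x \<in> W" for x
    using Suc.prems that assms(1)
    by (intro has_derivative_transform_within_open[of F _ x UNIV W G])
       (auto simp flip: frechet_derivative_works)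
  have eq: "frechet_derivative G (at x) = frechet_derivative F (at x)" if "x \<in> W" for x
    using frechet_derivative_at[OF dG[OF that]] by simp
  have "Ck_on k W (\<lambda>x. frechet_derivative G (at x) h)" for h
  proof (rule Suc.IH)
    show "Ck_on k W (\<lambda>x. frechet_derivative F (at x) h)"
      using Suc.prems by simp
  qed (simp add: eq)
  moreover have "\<forall>x\<in>W. G differentiable (at x)"
    using dG differentiableI by blast
  ultimately show ?case by simp
qed

text \<open>The slice s -> (v, s) has derivative h -> (0, h); composing with the total derivative
  turns the \<open>deriv\<close> in \<open>d_r\<close> into a directional Frechet
  derivative.\<close>

lemma differentiable_r:
  assumes "F differentiable (at (v, r))"
  shows "((\<lambda>s. F (v, s)) has_real_derivative d_r F (v, r)) (at r)"
    and "d_r F (v, r) = frechet_derivative F (at (v, r)) (0, 1)"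
proof -
  have "(F has_derivative frechet_derivative F (at (v, r))) (at (v, r))"
    using assms frechet_derivative_works by blast
  moreover have "((\<lambda>s. (v, s)) has_derivative (\<lambda>h. (0, h))) (at r)"
    by (auto intro!: derivative_eq_intros)
  ultimately have "((\<lambda>s. F (v, s)) has_derivative (\<lambda>h. frechet_derivative F (at (v, r)) (0, h))) (at r)"
    using has_derivative_compose by blast
  moreover have "(\<lambda>h. frechet_derivative F (at (v, r)) (0, h)) = (*) (frechet_derivative F (at (v, r)) (0, 1))"
    (is "?L = _")
  proof
    show "?L h = frechet_derivative F (at (v, r)) (0, 1) * h" for h
      using linear_cmul[OF linear_frechet_derivative[OF assms], of h "(0, 1)"]
      by (simp only: scaleR_Pair real_scaleR_def mult_zero_right mult_1_right mult.commute[of _ h])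
  qed
  ultimately have *: "((\<lambda>s. F (v, s)) has_real_derivative frechet_derivative F (at (v, r)) (0, 1)) (at r)"
    by (simp add: has_field_derivative_def)
  then show "d_r F (v, r) = frechet_derivative F (at (v, r)) (0, 1)"
    unfolding d_r_def by (simp add: DERIV_imp_deriv)
  with * show "((\<lambda>s. F (v, s)) has_real_derivative d_r F (v, r)) (at r)" by simp
qed

lemma differentiable_v:
  assumes "F differentiable (at (v, r))"
  shows "((\<lambda>s. F (s, r)) has_real_derivative d_v F (v, r)) (at v)"
    and "d_v F (v, r) = frechet_derivative F (at (v, r)) (1, 0)"
proof -
  have "(F has_derivative frechet_derivative F (at (v, r))) (at (v, r))"
    using assms frechet_derivative_works by blast
  moreover have "((\<lambda>s. (s, r)) has_derivative (\<lambda>h. (h, 0))) (at v)"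
    by (auto intro!: derivative_eq_intros)
  ultimately have "((\<lambda>s. F (s, r)) has_derivative (\<lambda>h. frechet_derivative F (at (v, r)) (h, 0))) (at v)"
    using has_derivative_compose by blast
  moreover have "(\<lambda>h. frechet_derivative F (at (v, r)) (h, 0)) = (*) (frechet_derivative F (at (v, r)) (1, 0))"
    (is "?L = _")
  proof
    show "?L h = frechet_derivative F (at (v, r)) (1, 0) * h" for h
      using linear_cmul[OF linear_frechet_derivative[OF assms], of h "(1, 0)"]
      by (simp only: scaleR_Pair real_scaleR_def mult_zero_right mult_1_right mult.commute[of _ h])
  qed
  ultimately have *: "((\<lambda>s. F (s, r)) has_real_derivative frechet_derivative F (at (v, r)) (1, 0)) (at v)"
    by (simp add: has_field_derivative_def)
  then show "d_v F (v, r) = frechet_derivative F (at (v, r)) (1, 0)"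
    unfolding d_v_def by (simp add: DERIV_imp_deriv)
  with * show "((\<lambda>s. F (s, r)) has_real_derivative d_v F (v, r)) (at v)" by simp
qed

text \<open>Chain rule for a curve in the (v, r) plane; it serves to differentiate the matching of
  Ricci scalars along Sigma.\<close>

lemma has_real_derivative_along_curve:
  fixes F :: "real \<times> real \<Rightarrow> real"
  assumes "F differentiable (at (T t, R t))"
    and "(T has_real_derivative T') (at t)" "(R has_real_derivative R') (at t)"
  shows "((\<lambda>t. F (T t, R t)) has_real_derivative
    T' * d_v F (T t, R t) + R' * d_r F (T t, R t)) (at t)"
proof -
  let ?D = "frechet_derivative F (at (T t, R t))"
  have "(F has_derivative ?D) (at (T t, R t))"
    using assms frechet_derivative_works by blast
  moreover have "((\<lambda>t. (T t, R t)) has_derivative (\<lambda>h. (h * T', h * R'))) (at t)"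
    using assms(2,3) by (auto intro!: derivative_eq_intros simp: has_field_derivative_def mult.commute)
  ultimately have D: "((\<lambda>t. F (T t, R t)) has_derivative (\<lambda>h. ?D (h * T', h * R'))) (at t)"
    using has_derivative_compose[of "\<lambda>t. (T t, R t)" _ t UNIV F ?D] by simp
  have "?D (h * T', h * R') = h * (T' * ?D (1, 0) + R' * ?D (0, 1))" for h
  proof -
    note lin = linear_frechet_derivative[OF assms(1)]
    have "(h * T', h * R') = (h * T') *\<^sub>R (1, 0) + (h * R') *\<^sub>R (0, 1)" by simp
    then have "?D (h * T', h * R') = (h * T') * ?D (1, 0) + (h * R') * ?D (0, 1)"
      by (simp only: linear_add[OF lin] linear_cmul[OF lin] real_scaleR_def)
    then show ?thesis by (simp add: algebra_simps)
  qed
  then have "(\<lambda>h. ?D (h * T', h * R')) =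
      (*) (T' * d_v F (T t, R t) + R' * d_r F (T t, R t))"
    unfolding differentiable_v(2)[OF assms(1)] differentiable_r(2)[OF assms(1)]
    by (auto simp: fun_eq_iff)
  with D show ?thesis
    by (simp add: has_field_derivative_def)
qed

lemma Ck_on_d_r:
  assumes "open W" "\<And>k. Ck_on k W F"
  shows "Ck_on k W (d_r F)"
proof (rule Ck_on_cong[OF assms(1)])
  show "Ck_on k W (\<lambda>x. frechet_derivative F (at x) (0, 1))"
    using assms(2)[of "Suc k"] by simp
  show "frechet_derivative F (at x) (0, 1) = d_r F x" if "x \<in> W" for x
    using assms(2)[of "Suc 0"] that differentiable_r(2)[of F "fst x" "snd x"] by simp
qed

section \<open>Derivatives of functions of one real variable\<close>

lemma real_derivative_frechet:
  fixes F :: "real \<Rightarrow> real"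
  assumes "F differentiable (at x)"
  shows "(F has_real_derivative frechet_derivative F (at x) 1) (at x)"
proof -
  have "(F has_real_derivative deriv F x) (at x)"
    using assms by (simp add: DERIV_deriv_iff_real_differentiable)
  moreover from this have "frechet_derivative F (at x) = (*) (deriv F x)"
    using frechet_derivative_at unfolding has_field_derivative_def by metis
  ultimately show ?thesis by simp
qed

lemma Ck_on_deriv:
  fixes F :: "real \<Rightarrow> real"
  assumes "open W" "\<And>k. Ck_on k W F"
  shows "Ck_on k W (deriv F)"
proof (rule Ck_on_cong[OF assms(1)])
  show "Ck_on k W (\<lambda>x. frechet_derivative F (at x) 1)"
    using assms(2)[of "Suc k"] by simp
  show "frechet_derivative F (at x) 1 = deriv F x" if "x \<in> W" for x
    using assms(2)[of "Suc 0"] that real_derivative_frechet[of F x] by (simp add: DERIV_imp_deriv)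
qed

lemma Ck_on_DERIV:
  fixes F :: "real \<Rightarrow> real"
  assumes "\<And>k. Ck_on k W F" "x \<in> W"
  shows "(F has_real_derivative deriv F x) (at x)"
  using assms(1)[of "Suc 0"] assms(2) by (simp add: DERIV_deriv_iff_real_differentiable)

text \<open>Integration from initial data: \<open>S\<close> will be a line of constant v inside the
  exterior, and \<open>c\<close> its endpoint on Sigma.\<close>

lemma DERIV_zero_imp_zero:
  fixes g :: "real \<Rightarrow> real"
  assumes "convex S" "\<And>x. x \<in> S \<Longrightarrow> (g has_real_derivative 0) (at x)"
    and "c \<in> S" "g c = 0" "x \<in> S"
  shows "g x = 0"
proof -
  have "\<exists>d. \<forall>x\<in>S. g x = d"
    by (rule has_field_derivative_zero_constant[OF assms(1)])
       (use assms(2) in \<open>blast intro: has_field_derivative_at_within\<close>)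
  then show ?thesis using assms by metis
qed

subsection \<open>Curvature of the generalized Vaidya metric\<close>

lemma num4_distinct:
  "(1::4) \<noteq> 2" "(1::4) \<noteq> 3" "(1::4) \<noteq> 4" "(2::4) \<noteq> 3" "(2::4) \<noteq> 4" "(3::4) \<noteq> 4"
  by simp_all

lemma vector_4 [simp]:
  "(vector [x, y, z, w] :: ('a::zero)^4) $ 1 = x"
  "(vector [x, y, z, w] :: ('a::zero)^4) $ 2 = y"
  "(vector [x, y, z, w] :: ('a::zero)^4) $ 3 = z"
  "(vector [x, y, z, w] :: ('a::zero)^4) $ 4 = w"
  unfolding vector_def by simp_all

text \<open>\<open>matrix_inv\<close> is a Hilbert choice, so its defining property is available
  only once a two-sided inverse is exhibited; \<open>B\<close> is that witness.\<close>

lemma matrix_inv_unique: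
  fixes A B :: "'a::semiring_1 ^ 'n ^ 'n"
  assumes AB: "A ** B = mat 1" and BA: "B ** A = mat 1"
  shows "matrix_inv A = B"
proof -
  have "A ** matrix_inv A = mat 1 \<and> matrix_inv A ** A = mat 1"
    unfolding matrix_inv_def by (rule someI[of _ B]) (use assms in blast)
  then show ?thesis
    by (metis AB matrix_mul_assoc matrix_mul_lid matrix_mul_rid)
qed

lemma inv_metric_vaidya:
  assumes "x $ 2 > 0" "0 < x $ 3" "x $ 3 < pi"
  shows "inv_metric (vaidya_metric M) x = vector
     [vector [0, 1, 0, 0],
      vector [1, 1 - 2 * M (x $ 1, x $ 2) / x $ 2, 0, 0],
      vector [0, 0, 1 / (x $ 2)\<^sup>2, 0],
      vector [0, 0, 0, 1 / ((x $ 2)\<^sup>2 * (sin (x $ 3))\<^sup>2)]]" (is "_ = ?B")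
proof -
  have "sin (x $ 3) \<noteq> 0" using sin_gt_zero assms by force
  then have "vaidya_metric M x ** ?B = mat 1" "?B ** vaidya_metric M x = mat 1"
    using assms
    by (simp_all add: vaidya_metric_def Let_def matrix_matrix_mult_def vec_eq_iff forall_4 sum_4 vector_4 mat_def)
  then show ?thesis unfolding inv_metric_def
    by (rule matrix_inv_unique)
qed

section \<open>Coordinate derivatives and their locality\<close>

lemma pd_eqI:
  "((\<lambda>h. F (x + h *\<^sub>R axis i 1)) has_real_derivative D) (at 0) \<Longrightarrow> pd i F x = D"
  unfolding pd_def by (rule DERIV_imp_deriv)

lemma pd_2_profile: "pd 2 (\<lambda>y. G (y $ 1, y $ 2)) x = d_r G (x $ 1, x $ 2)"
proof -
  \<comment> \<open>Both sides admit the same derivatives \<open>D\<close>, so the choices made by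
    \<open>deriv\<close> coincide even where no derivative exists.\<close>
  have "((\<lambda>h. G (x $ 1, x $ 2 + h)) has_real_derivative D) (at 0) \<longleftrightarrow>
    ((\<lambda>s. G (x $ 1, s)) has_real_derivative D) (at (x $ 2))" for D
    using DERIV_shift[of "\<lambda>s. G (x $ 1, s)" D 0 "x $ 2"] by (simp add: add.commute)
  then show ?thesis
    by (simp add: pd_def d_r_def deriv_def axis_def)
qed

lemma eventually_along_axis:
  fixes E :: "event set"
  assumes "open E" "x \<in> E"
  shows "\<forall>\<^sub>F h in nhds 0. x + h *\<^sub>R axis i 1 \<in> E"
proof -
  have "((\<lambda>h. x + h *\<^sub>R axis i 1) \<longlongrightarrow> x + 0 *\<^sub>R axis i 1) (nhds (0::real))"
    by (intro tendsto_intros filterlim_ident)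
  then show ?thesis
    using topological_tendstoD[OF _ assms(1)] assms(2) by fastforce
qed

lemma pd_cong:
  fixes E :: "event set"
  assumes "open E" "x \<in> E" "\<And>y. y \<in> E \<Longrightarrow> F y = G y"
  shows "pd i F x = pd i G x"
  unfolding pd_def
proof (rule deriv_cong_ev)
  show "\<forall>\<^sub>F h in nhds 0. F (x + h *\<^sub>R axis i 1) = G (x + h *\<^sub>R axis i 1)"
    using eventually_along_axis[OF assms(1,2)] by (rule eventually_mono) (rule assms(3))
qed simp

lemma open_exterior_events:
  assumes "open W"
  shows "open (exterior_events W)"
proof -
  have "exterior_events W = (\<lambda>x. (x $ 1, x $ 2)) -` W \<inter> {x. 0 < x $ 3} \<inter> {x. x $ 3 < pi}"
    unfolding exterior_events_def by auto
  moreover have "open ((\<lambda>x::event. (x $ 1, x $ 2)) -` W)"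
    by (intro open_vimage assms continuous_intros)
  moreover have "open {x::event. 0 < x $ 3}" "open {x::event. x $ 3 < pi}"
    by (intro open_Collect_less continuous_intros)+
  ultimately show ?thesis by auto
qed

text \<open>The outermost index is the upper one. The abbreviation \<open>k\<close> is half the
  r-derivative of 1 - 2M/r, that is, of -g_vv. Nested vectors let the simplifier read off single
  components.\<close>

definition vaidya_christoffel :: "(real \<times> real \<Rightarrow> real) \<Rightarrow> 4 \<Rightarrow> 4 \<Rightarrow> 4 \<Rightarrow> event \<Rightarrow> real" where
  "vaidya_christoffel M l m n x =
    (let q = (x $ 1, x $ 2); r = x $ 2; s = sin (x $ 3); c = cos (x $ 3);
         k = M q / r\<^sup>2 - d_r M q / r
     in (vector
      [vector [vector [k, 0, 0, 0],
               vector [0, 0, 0, 0],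
               vector [0, 0, - r, 0],
               vector [0, 0, 0, - r * s\<^sup>2]],
       vector [vector [d_v M q / r + (1 - 2 * M q / r) * k, - k, 0, 0],
               vector [- k, 0, 0, 0],
               vector [0, 0, 2 * M q - r, 0],
               vector [0, 0, 0, (2 * M q - r) * s\<^sup>2]],
       vector [vector [0, 0, 0, 0],
               vector [0, 0, 1 / r, 0],
               vector [0, 1 / r, 0, 0],
               vector [0, 0, 0, - s * c]],
       vector [vector [0, 0, 0, 0],
               vector [0, 0, 0, 1 / r],
               vector [0, 0, 0, c / s],
               vector [0, 1 / r, c / s, 0]]] :: real ^ 4 ^ 4 ^ 4) $ l $ m $ n)"

text \<open>The exterior region contains its boundary Sigma; two-sided derivatives there are taken
  in an open neighbourhood, whose role \<open>W\<close> plays. Positivity of r keeps all divisions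
  meaningful.\<close>

locale smooth_mass =
  fixes M :: "real \<times> real \<Rightarrow> real" and W :: "(real \<times> real) set"
  assumes open_W: "open W"
    and pos: "\<And>v r. (v, r) \<in> W \<Longrightarrow> r > 0"
    and smooth: "\<And>k. Ck_on k W M"
begin

lemma smooth_iterate_d_r: "Ck_on k W ((d_r ^^ n) M)"
  by (induction n arbitrary: k) (auto intro: Ck_on_d_r open_W smooth)

lemma differentiable_iterate_d_r:
  "q \<in> W \<Longrightarrow> (d_r ^^ n) M differentiable (at q)"
  using smooth_iterate_d_r[of "Suc 0" n] by simp

lemma DERIV_iterate_d_r:
  assumes "(v, r) \<in> W"
  shows "((\<lambda>s. (d_r ^^ n) M (v, s)) has_real_derivative d_r ((d_r ^^ n) M) (v, r)) (at r)"
  by (rule differentiable_r(1)[OF differentiable_iterate_d_r[OF assms]])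

lemma pd_metric:
  assumes "x \<in> exterior_events W"
  shows "pd k (\<lambda>y. vaidya_metric M y $ m $ n) x =
    (if m = 1 \<and> n = 1 then
       if k = 1 then 2 * d_v M (x $ 1, x $ 2) / x $ 2
       else if k = 2 then 2 * d_r M (x $ 1, x $ 2) / x $ 2 - 2 * M (x $ 1, x $ 2) / (x $ 2)\<^sup>2
       else 0
     else if m = 3 \<and> n = 3 then if k = 2 then 2 * x $ 2 else 0
     else if m = 4 \<and> n = 4 then
       if k = 2 then 2 * x $ 2 * (sin (x $ 3))\<^sup>2
       else if k = 3 then 2 * (x $ 2)\<^sup>2 * sin (x $ 3) * cos (x $ 3)
       else 0
     else 0)"
proof -
  have q: "(x $ 1, x $ 2) \<in> W" using assms by (simp add: exterior_events_def)
  have r: "x $ 2 > 0" using pos q by blast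
  have D: "M differentiable (at (x $ 1, x $ 2))"
    using differentiable_iterate_d_r[OF q, of 0] by simp
  have Dv: "((\<lambda>h. M (x $ 1 + h, x $ 2)) has_real_derivative d_v M (x $ 1, x $ 2)) (at 0)"
    using differentiable_v(1)[OF D] DERIV_shift[of "\<lambda>s. M (s, x $ 2)" _ "0" "x $ 1"] by (simp add: add.commute)
  have Dr: "((\<lambda>h. M (x $ 1, h + x $ 2)) has_real_derivative d_r M (x $ 1, x $ 2)) (at 0)"
    using differentiable_r(1)[OF D] DERIV_shift[of "\<lambda>s. M (x $ 1, s)" _ "0" "x $ 2"] by (simp add: add.commute)
  note comps = vaidya_metric_def Let_def axis_def
  have 11: "pd 1 (\<lambda>y. vaidya_metric M y $ 1 $ 1) x = 2 * d_v M (x $ 1, x $ 2) / x $ 2"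
    by (rule pd_eqI) (use r in \<open>auto simp: comps intro!: derivative_eq_intros Dv\<close>)
  have 12: "pd 2 (\<lambda>y. vaidya_metric M y $ 1 $ 1) x =
    2 * d_r M (x $ 1, x $ 2) / x $ 2 - 2 * M (x $ 1, x $ 2) / (x $ 2)\<^sup>2"
    by (rule pd_eqI) (use r in \<open>auto simp: comps field_simps power2_eq_square intro!: derivative_eq_intros Dr\<close>)
  have 32: "pd 2 (\<lambda>y. vaidya_metric M y $ 3 $ 3) x = 2 * x $ 2"
    by (rule pd_eqI) (auto simp: comps intro!: derivative_eq_intros)
  have 42: "pd 2 (\<lambda>y. vaidya_metric M y $ 4 $ 4) x = 2 * x $ 2 * (sin (x $ 3))\<^sup>2"
    by (rule pd_eqI) (auto simp: comps intro!: derivative_eq_intros)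
  have 43: "pd 3 (\<lambda>y. vaidya_metric M y $ 4 $ 4) x = 2 * (x $ 2)\<^sup>2 * sin (x $ 3) * cos (x $ 3)"
    by (rule pd_eqI) (auto simp: comps intro!: derivative_eq_intros)
  \<comment> \<open>Every remaining pair of component and direction is constant along the coordinate
    line; the case split over all indices leaves exactly these.\<close>
  have 0: "pd k (\<lambda>y. vaidya_metric M y $ m $ n) x = 0"
    if "\<And>h. vaidya_metric M (x + h *\<^sub>R axis k 1) $ m $ n = vaidya_metric M x $ m $ n" for k m n
    by (rule pd_eqI) (simp add: that)
  show ?thesis
    using exhaust_4[of k] exhaust_4[of m] exhaust_4[of n]
  proof (elim disjE, simp_all only: num4_distinct num4_distinct[symmetric] 11 12 32 42 43
      simp_thms if_True if_False)
  qed (rule 0; simp add: comps)+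
qed

lemma christoffel_vaidya:
  assumes "x \<in> exterior_events W"
  shows "christoffel (vaidya_metric M) l m n x = vaidya_christoffel M l m n x"
proof -
  have q: "(x $ 1, x $ 2) \<in> W" "0 < x $ 3" "x $ 3 < pi" using assms by (auto simp: exterior_events_def)
  have r: "x $ 2 > 0" using pos q by blast
  have s: "sin (x $ 3) > 0" using q sin_gt_zero by blast
  show ?thesis
    unfolding christoffel_def vaidya_christoffel_def Let_def sum_4
      inv_metric_vaidya[OF r q(2,3)] pd_metric[OF assms]
    using exhaust_4[of l] exhaust_4[of m] exhaust_4[of n] r s
    by (elim disjE; simp add: field_simps power2_eq_square)
qed


text \<open>The closed form of the symbols holds only over \<open>W\<close>, but openness of the
  chart part over \<open>W\<close> makes this enough for their derivatives.\<close>

lemma pd_christoffel: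
  assumes "x \<in> exterior_events W"
  shows "pd i (christoffel (vaidya_metric M) l m n) x = pd i (vaidya_christoffel M l m n) x"
  by (rule pd_cong[OF open_exterior_events[OF open_W] assms]) (rule christoffel_vaidya)

text \<open>These are the components that meet a nonzero entry of the inverse metric in the trace;
  the vv component meets g^vv = 0. The 22 component also enters the rr field equation.\<close>

lemma ricci_vaidya:
  assumes "x \<in> exterior_events W"
  defines "q \<equiv> (x $ 1, x $ 2)" and "r \<equiv> x $ 2"
  shows "ricci (vaidya_metric M) x $ 1 $ 2 = d_r (d_r M) q / r"
    and "ricci (vaidya_metric M) x $ 2 $ 1 = d_r (d_r M) q / r"
    and "ricci (vaidya_metric M) x $ 2 $ 2 = 0"
    and "ricci (vaidya_metric M) x $ 3 $ 3 = 2 * d_r M q"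
    and "ricci (vaidya_metric M) x $ 4 $ 4 = 2 * d_r M q * (sin (x $ 3))\<^sup>2"
proof -
  have qW: "(x $ 1, x $ 2) \<in> W" "0 < x $ 3" "x $ 3 < pi"
    using assms(1) by (auto simp: exterior_events_def)
  have r: "x $ 2 > 0" using pos qW by blast
  have s: "sin (x $ 3) > 0" using qW sin_gt_zero by blast
  define m0 m1 m2 where "m0 = M q" and "m1 = d_r M q" and "m2 = d_r (d_r M) q"
  have D0: "((\<lambda>h. M (x $ 1, x $ 2 + h)) has_real_derivative m1) (at 0)"
    using DERIV_iterate_d_r[OF qW(1), of 0]
      DERIV_shift[of "\<lambda>s. M (x $ 1, s)" _ "0" "x $ 2"]
    by (simp add: add.commute q_def m1_def)
  have D1: "((\<lambda>h. d_r M (x $ 1, x $ 2 + h)) has_real_derivative m2) (at 0)"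
    using DERIV_iterate_d_r[OF qW(1), of 1]
      DERIV_shift[of "\<lambda>s. d_r M (x $ 1, s)" _ "0" "x $ 2"]
    by (simp add: add.commute q_def m2_def)
  note comps = vaidya_christoffel_def Let_def axis_def
  let ?\<Gamma> = "vaidya_christoffel M"
  \<comment> \<open>The r-derivative of the abbreviation \<open>k\<close> in
    \<open>vaidya_christoffel\<close>.\<close>
  let ?k' = "m1 / r\<^sup>2 - 2 * m0 / r ^ 3 - m2 / r + m1 / r\<^sup>2"
  have P: "((\<lambda>h. x $ 2 + h) has_real_derivative 1) (at 0)"
    by (auto intro!: derivative_eq_intros)
  have k: "((\<lambda>h. M (x $ 1, x $ 2 + h) / (x $ 2 + h)\<^sup>2 - d_r M (x $ 1, x $ 2 + h) / (x $ 2 + h))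
      has_real_derivative ?k') (at 0)"
    by (rule DERIV_cong[OF DERIV_diff[OF DERIV_divide[OF D0 DERIV_power[OF P]] DERIV_divide[OF D1 P]]])
       (use r in \<open>simp_all add: field_simps eval_nat_numeral m0_def m1_def q_def r_def\<close>)
  have minus_k: "((\<lambda>h. d_r M (x $ 1, x $ 2 + h) / (x $ 2 + h) - M (x $ 1, x $ 2 + h) / (x $ 2 + h)\<^sup>2)
      has_real_derivative - ?k') (at 0)"
    using DERIV_minus[OF k] by simp
  have G111: "pd 2 (?\<Gamma> 1 1 1) x = ?k'"
    by (rule pd_eqI) (use k in \<open>simp add: comps\<close>)
  have G212: "pd 2 (?\<Gamma> 2 1 2) x = - ?k'"
    by (rule pd_eqI) (use minus_k in \<open>simp add: comps\<close>)
  have G221: "pd 2 (?\<Gamma> 2 2 1) x = - ?k'"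
    by (rule pd_eqI) (use minus_k in \<open>simp add: comps\<close>)
  have r_inv: "((\<lambda>h. 1 / (x $ 2 + h)) has_real_derivative - 1 / r\<^sup>2) (at 0)"
    by (rule derivative_eq_intros refl | use r in \<open>simp add: r_def power2_eq_square\<close>)+
  have G323: "pd 2 (?\<Gamma> 3 2 3) x = - 1 / r\<^sup>2"
    by (rule pd_eqI) (use r_inv in \<open>simp add: comps\<close>)
  have G424: "pd 2 (?\<Gamma> 4 2 4) x = - 1 / r\<^sup>2"
    by (rule pd_eqI) (use r_inv in \<open>simp add: comps\<close>)
  have rM: "((\<lambda>h. 2 * M (x $ 1, x $ 2 + h) - (x $ 2 + h)) has_real_derivative 2 * m1 - 1) (at 0)"
    using DERIV_diff[OF DERIV_cmult[OF D0, of 2] P] by simp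
  have G233: "pd 2 (?\<Gamma> 2 3 3) x = 2 * m1 - 1"
    by (rule pd_eqI) (use rM in \<open>simp add: comps\<close>)
  have G244: "pd 2 (?\<Gamma> 2 4 4) x = (2 * m1 - 1) * (sin (x $ 3))\<^sup>2"
    by (rule pd_eqI) (use DERIV_cmult_right[OF rM, of "(sin (x $ 3))\<^sup>2"] in \<open>simp add: comps\<close>)
  have G344: "pd 3 (?\<Gamma> 3 4 4) x = (sin (x $ 3))\<^sup>2 - (cos (x $ 3))\<^sup>2"
    by (rule pd_eqI) (auto simp: comps power2_eq_square intro!: derivative_eq_intros)
  have "((\<lambda>h. cos (x $ 3 + h) / sin (x $ 3 + h)) has_real_derivative
      (- sin (x $ 3) * sin (x $ 3) - cos (x $ 3) * cos (x $ 3)) / (sin (x $ 3) * sin (x $ 3))) (at 0)"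
    by (rule derivative_eq_intros refl | use s in simp)+
  moreover have "- sin (x $ 3) * sin (x $ 3) - cos (x $ 3) * cos (x $ 3) = - 1"
    using sin_cos_squared_add[of "x $ 3"] by (simp add: power2_eq_square)
  ultimately have cot: "((\<lambda>h. cos (x $ 3 + h) / sin (x $ 3 + h)) has_real_derivative
      - 1 / (sin (x $ 3))\<^sup>2) (at 0)"
    by (simp add: power2_eq_square)
  have G434: "pd 3 (?\<Gamma> 4 3 4) x = - 1 / (sin (x $ 3))\<^sup>2"
    by (rule pd_eqI) (use cot in \<open>simp add: comps\<close>)
  note G = G111 G212 G221 G323 G424 G233 G244 G344 G434
  have Z: "pd i (?\<Gamma> l m n) x = 0"
    if "\<And>h. ?\<Gamma> l m n (x + h *\<^sub>R axis i 1) = ?\<Gamma> l m n x" for i l m n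
    by (rule pd_eqI) (simp add: that)
  note unfold = ricci_def vec_lambda_beta pd_christoffel[OF assms(1)] christoffel_vaidya[OF assms(1)] sum_4 G
  show "ricci (vaidya_metric M) x $ 1 $ 2 = d_r (d_r M) q / r"
    unfolding unfold
    by (use r s in \<open>simp add: Z comps m0_def m1_def m2_def q_def r_def, simp add: field_simps eval_nat_numeral\<close>)
  show "ricci (vaidya_metric M) x $ 2 $ 1 = d_r (d_r M) q / r"
    unfolding unfold
    by (use r s in \<open>simp add: Z comps m0_def m1_def m2_def q_def r_def, simp add: field_simps eval_nat_numeral\<close>)
  show "ricci (vaidya_metric M) x $ 2 $ 2 = 0"
    unfolding unfold
    by (use r s in \<open>simp add: Z comps m0_def m1_def m2_def q_def r_def, (simp add: field_simps eval_nat_numeral)?\<close>)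
  show "ricci (vaidya_metric M) x $ 3 $ 3 = 2 * d_r M q"
    unfolding unfold
    by (use r s in \<open>simp add: Z comps m0_def m1_def m2_def q_def r_def, simp add: field_simps eval_nat_numeral\<close>)
  show "ricci (vaidya_metric M) x $ 4 $ 4 = 2 * d_r M q * (sin (x $ 3))\<^sup>2"
    unfolding unfold
    by (use r s in \<open>simp add: Z comps m0_def m1_def m2_def q_def r_def, simp add: field_simps eval_nat_numeral\<close>)
qed

text \<open>As R_rr = 0, the trace is 2 R_vr plus two equal angular terms 2 M_r / r^2; the factors
  of sin cancel, so no dependence on the angle survives.\<close>

lemma ricci_scalar_vaidya:
  assumes "x \<in> exterior_events W"
  shows "ricci_scalar (vaidya_metric M) x = R_plus M (x $ 1, x $ 2)"
proof -
  have q: "(x $ 1, x $ 2) \<in> W" "0 < x $ 3" "x $ 3 < pi" using assms by (auto simp: exterior_events_def)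
  have r: "x $ 2 > 0" using pos q by blast
  have s: "sin (x $ 3) > 0" using q sin_gt_zero by blast
  show ?thesis
    unfolding ricci_scalar_def trace_metric_def sum_4 inv_metric_vaidya[OF r q(2,3)]
    using r s by (simp add: ricci_vaidya[OF assms] R_plus_def field_simps power2_eq_square)
qed

section \<open>Regularity of the Ricci scalar as a function of v and r\<close>

lemma differentiable_R_plus:
  assumes "q \<in> W"
  shows "R_plus M differentiable (at q)"
proof -
  obtain v r where q: "q = (v, r)" by force
  have "r > 0" using pos assms q by blast
  note D = differentiable_iterate_d_r[OF assms, of 1] differentiable_iterate_d_r[OF assms, of 2]
  have "(\<lambda>q. 2 / (snd q)\<^sup>2 * (snd q * (d_r ^^ 2) M q + 2 * (d_r ^^ 1) M q)) differentiable (at q)"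
    by (intro derivative_intros D bounded_linear_imp_differentiable[OF bounded_linear_snd]) (use \<open>r > 0\<close> q in auto)
  moreover have "R_plus M = (\<lambda>q. 2 / (snd q)\<^sup>2 * (snd q * (d_r ^^ 2) M q + 2 * (d_r ^^ 1) M q))"
    by (auto simp: R_plus_def fun_eq_iff numeral_2_eq_2)
  ultimately show ?thesis by simp
qed

text \<open>Writing the derivative through iterates of \<open>d_r\<close> on \<open>M\<close> lets
  its own differentiability be inherited from theirs.\<close>

lemma d_r_R_plus:
  assumes "(v, r) \<in> W"
  shows "d_r (R_plus M) (v, r) =
    2 * (d_r ^^ 3) M (v, r) / r + 2 * (d_r ^^ 2) M (v, r) / r\<^sup>2 - 8 * (d_r ^^ 1) M (v, r) / r ^ 3"
proof -
  have "r > 0" using pos assms by blast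
  note D = DERIV_iterate_d_r[OF assms, of 1] DERIV_iterate_d_r[OF assms, of 2]
  have "((\<lambda>s. 2 / s\<^sup>2 * (s * (d_r ^^ 2) M (v, s) + 2 * (d_r ^^ 1) M (v, s))) has_real_derivative
    2 * (d_r ^^ 3) M (v, r) / r + 2 * (d_r ^^ 2) M (v, r) / r\<^sup>2 - 8 * (d_r ^^ 1) M (v, r) / r ^ 3) (at r)"
    by (rule derivative_eq_intros D refl | use \<open>r > 0\<close> in \<open>simp add: field_simps eval_nat_numeral\<close>)+
  then show ?thesis
    by (simp add: d_r_def R_plus_def DERIV_imp_deriv eval_nat_numeral)
qed

lemma differentiable_d_r_R_plus:
  assumes "q \<in> W"
  shows "d_r (R_plus M) differentiable (at q)"
proof -
  obtain v r where q: "q = (v, r)" by force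
  have "r > 0" using pos assms q by blast
  let ?F = "\<lambda>q. 2 * (d_r ^^ 3) M q / snd q + 2 * (d_r ^^ 2) M q / (snd q)\<^sup>2 - 8 * (d_r ^^ 1) M q / snd q ^ 3"
  have "?F differentiable (at q)"
    by (intro derivative_intros differentiable_iterate_d_r assms
        bounded_linear_imp_differentiable[OF bounded_linear_snd]) (use \<open>r > 0\<close> q in auto)
  then obtain F' where F': "(?F has_derivative F') (at q)" by (auto simp: differentiable_def)
  have "(d_r (R_plus M) has_derivative F') (at q)"
    by (rule has_derivative_transform_within_open[OF F' open_W assms]) (auto simp: d_r_R_plus simp del: funpow.simps)
  then show ?thesis by (auto simp: differentiable_def)
qed

lemma field_equation_rr:
  assumes "solves_fR_vaidya f \<kappa> U M" "(v, r) \<in> U" "(v, r) \<in> W"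
  shows "d_r (d_r (\<lambda>q. deriv f (R_plus M q))) (v, r) = 0"
proof -
  \<comment> \<open>The point (v, r) is lifted to the equator, which lies inside the chart.\<close>
  define x :: event where "x = vector [v, r, pi / 2, 0]"
  have xU: "x \<in> exterior_events U" and xW: "x \<in> exterior_events W"
    using assms(2,3) by (auto simp: x_def exterior_events_def)
  let ?g = "vaidya_metric M" and ?F = "\<lambda>x. deriv f (ricci_scalar (vaidya_metric M) x)"
    and ?H = "\<lambda>q. deriv f (R_plus M q)"
  obtain \<mu> \<rho> p where eq: "\<And>m n. ?F x * ricci ?g x $ m $ n - 1 / 2 * f (ricci_scalar ?g x) * ?g x $ m $ n
      + (?g x $ m $ n * dalembertian ?g ?F x - cov_hessian ?g ?F x $ m $ n)
      = \<kappa> * vaidya_stress M \<mu> \<rho> p x $ m $ n"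
    using assms(1) xU unfolding solves_fR_vaidya_def fR_field_equations_def Let_def by blast
  have "?g x $ 2 $ 2 = 0" "vaidya_stress M \<mu> \<rho> p x $ 2 $ 2 = 0"
    by (simp_all add: vaidya_metric_def Let_def vaidya_stress_def vaidya_l_def axis_def)
  then have "cov_hessian ?g ?F x $ 2 $ 2 = 0"
    using eq[of 2 2] ricci_vaidya(3)[OF xW] by simp
  then have "pd 2 (pd 2 ?F) x = 0"
    by (simp add: cov_hessian_def sum_4 christoffel_vaidya[OF xW] vaidya_christoffel_def Let_def)
  \<comment> \<open>The first derivatives must agree on a whole neighbourhood, since they are
    differentiated once more.\<close>
  moreover have "pd 2 ?F y = d_r ?H (y $ 1, y $ 2)" if "y \<in> exterior_events W" for y
    using pd_cong[OF open_exterior_events[OF open_W] that, of ?F "\<lambda>y. ?H (y $ 1, y $ 2)"]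
    by (simp add: ricci_scalar_vaidya pd_2_profile[of ?H])
  then have "pd 2 (pd 2 ?F) x = pd 2 (\<lambda>y. d_r ?H (y $ 1, y $ 2)) x"
    by (rule pd_cong[OF open_exterior_events[OF open_W] xW])
  ultimately show ?thesis
    by (simp add: pd_2_profile x_def)
qed

lemma DERIV_fR:
  assumes "\<And>k. Ck_on k D f" "(v, r) \<in> W" "R_plus M (v, r) \<in> D" "open D"
  shows "((\<lambda>s. deriv f (R_plus M (v, s))) has_real_derivative
      d_r (\<lambda>q. deriv f (R_plus M q)) (v, r)) (at r)"
    and "d_r (\<lambda>q. deriv f (R_plus M q)) (v, r) =
      deriv (deriv f) (R_plus M (v, r)) * d_r (R_plus M) (v, r)"
proof -
  have "((\<lambda>s. deriv f (R_plus M (v, s))) has_real_derivative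
      deriv (deriv f) (R_plus M (v, r)) * d_r (R_plus M) (v, r)) (at r)"
    by (rule DERIV_chain2[OF Ck_on_DERIV[OF Ck_on_deriv[OF assms(4,1)] assms(3)]
          differentiable_r(1)[OF differentiable_R_plus[OF assms(2)]]])
  then show "d_r (\<lambda>q. deriv f (R_plus M q)) (v, r) =
      deriv (deriv f) (R_plus M (v, r)) * d_r (R_plus M) (v, r)"
    and "((\<lambda>s. deriv f (R_plus M (v, s))) has_real_derivative
      d_r (\<lambda>q. deriv f (R_plus M q)) (v, r)) (at r)"
    by (simp_all add: d_r_def DERIV_imp_deriv)
qed

text \<open>Equations on \<open>d_r (d_r ...)\<close> concern a value of \<open>deriv\<close>, which
  describes a rate of change only where a derivative exists. This lemma supplies that existence, so
  that the rr equation can be integrated.\<close>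

lemma DERIV_d_r_fR:
  assumes f: "\<And>k. Ck_on k D f" "open D" and q: "(v, r) \<in> W" "R_plus M (v, r) \<in> D"
  shows "((\<lambda>s. d_r (\<lambda>q. deriv f (R_plus M q)) (v, s)) has_real_derivative
      d_r (d_r (\<lambda>q. deriv f (R_plus M q))) (v, r)) (at r)"
proof -
  let ?H = "\<lambda>q. deriv f (R_plus M q)"
  let ?S = "{s. (v, s) \<in> W \<and> R_plus M (v, s) \<in> D}"
  have "((\<lambda>s. deriv (deriv f) (R_plus M (v, s))) has_real_derivative
      deriv (deriv (deriv f)) (R_plus M (v, r)) * d_r (R_plus M) (v, r)) (at r)"
    by (rule DERIV_chain2[OF Ck_on_DERIV[OF Ck_on_deriv[OF f(2) Ck_on_deriv[OF f(2,1)]] q(2)]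
          differentiable_r(1)[OF differentiable_R_plus[OF q(1)]]])
  from DERIV_mult[OF this differentiable_r(1)[OF differentiable_d_r_R_plus[OF q(1)]]]
  obtain d where d: "((\<lambda>s. deriv (deriv f) (R_plus M (v, s)) * d_r (R_plus M) (v, s))
      has_real_derivative d) (at r)" by blast
  have "continuous_on W (R_plus M)"
    using differentiable_R_plus by (simp add: continuous_at_imp_continuous_on differentiable_imp_continuous_within)
  then have "open (W \<inter> R_plus M -` D)"
    using continuous_open_preimage[OF _ open_W f(2)] by blast
  then have "open ((\<lambda>s. (v, s)) -` (W \<inter> R_plus M -` D))"
    by (rule open_vimage) (intro continuous_intros)
  moreover have "(\<lambda>s. (v, s)) -` (W \<inter> R_plus M -` D) = ?S" by auto
  ultimately have "open ?S" by simp
  \<comment> \<open>The product formula from \<open>DERIV_fR\<close> holds throughout the open set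
    \<open>?S\<close>, so its derivative transfers; the mere existence of some \<open>d\<close> then
    identifies it with \<open>deriv\<close>.\<close>
  then have "((\<lambda>s. d_r ?H (v, s)) has_real_derivative d) (at r)"
    by (rule has_field_derivative_transform_within_open[OF d]) (use q DERIV_fR(2)[OF f(1) _ _ f(2)] in auto)
  then show ?thesis
    by (simp add: d_r_def DERIV_imp_deriv)
qed

end

subsection \<open>Uniqueness of the exterior\<close>

text \<open>Intersecting a neighbourhood of smoothness with the half plane r > 0 keeps it open and
  still containing \<open>U\<close>; \<open>Ck_on\<close> restricts to subsets.\<close>

lemma smooth_mass_neighbourhood:
  assumes "smooth_on U M" "\<And>v r. (v, r) \<in> U \<Longrightarrow> r > 0"
  obtains W where "smooth_mass M W" "U \<subseteq> W"
proof -
  obtain W where W: "open W" "U \<subseteq> W" "\<And>k. Ck_on k W M"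
    using assms(1) unfolding smooth_on_def by blast
  have sub: "Ck_on k W' F" if "Ck_on k W F" "W' \<subseteq> W" for k F and W' :: "(real \<times> real) set"
    using that(1)
  proof (induction k arbitrary: F)
    case 0
    then show ?case using continuous_on_subset that(2) by auto
  next
    case (Suc k)
    then show ?case using that(2) by auto
  qed
  have "open (W \<inter> {q. 0 < snd q})"
    by (intro open_Int W open_Collect_less continuous_intros)
  then have "smooth_mass M (W \<inter> {q. 0 < snd q})"
    by unfold_locales (use sub[OF W(3)] in auto)
  moreover have "U \<subseteq> W \<inter> {q. 0 < snd q}" using W(2) assms(2) by auto
  ultimately show thesis using that by blast
qed

theorem proposition7:
  fixes f a \<T> \<R> \<Phi> :: "real \<Rightarrow> real"
    and r0 \<kappa> :: real
    and D J \<O> :: "real set"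
    and rmax :: "real \<Rightarrow> ereal"
    and M1 M2 :: "real \<times> real \<Rightarrow> real"
  assumes f: "open D" "smooth_on D f"
    and r0: "r0 > 0"
    and J: "open J" "is_interval J"
    and a: "smooth_on J a" "\<forall>t\<in>J. a t > 0" "\<forall>t\<in>J. 1 - r0 * deriv a t \<noteq> 0"
    and R: "\<forall>t\<in>J. \<R> t = r0 * a t"
    and T: "\<forall>t\<in>J. (\<T> has_real_derivative 1 / (1 - r0 * deriv a t)) (at t)" "inj_on \<T> J"
    and fR: "open \<O>" "is_interval \<O>" "\<O> \<subseteq> D" "R_minus a ` J \<subseteq> \<O>"
      "inj_on (deriv f) \<O>" "\<Phi> = the_inv_into \<O> (deriv f)"
    and fRR: "\<forall>t\<in>J. deriv (deriv f) (R_minus a t) \<noteq> 0"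
    and rmax: "\<forall>t\<in>J. ereal (\<R> t) < rmax (\<T> t)"
    and M: "\<forall>M\<in>{M1, M2}.
      smooth_on (exterior_region J \<T> \<R> rmax) M \<and>
      (\<forall>x\<in>exterior_events (exterior_region J \<T> \<R> rmax).
         ricci_scalar (vaidya_metric M) x \<in> \<O>) \<and>
      solves_fR_vaidya f \<kappa> (exterior_region J \<T> \<R> rmax) M \<and>
      matches_flrw r0 a J \<T> \<R> M"
  shows "\<forall>q\<in>exterior_region J \<T> \<R> rmax. M1 q = M2 q"
proof
  fix q assume "q \<in> exterior_region J \<T> \<R> rmax"
  then obtain t r where t: "t \<in> J" and q: "q = (\<T> t, r)" and r: "\<R> t \<le> r" "ereal r < rmax (\<T> t)"
    by (auto simp: exterior_region_def)
  let ?U = "exterior_region J \<T> \<R> rmax"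
  define v where "v = \<T> t"
  \<comment> \<open>The slice of the exterior at fixed v, an interval that includes its endpoint
    \<open>\<R> t\<close> on Sigma.\<close>
  define I where "I = {s. \<R> t \<le> s \<and> ereal s < rmax v}"
  have I: "convex I" "\<R> t \<in> I" "r \<in> I"
  proof -
    show "convex I"
      unfolding is_interval_convex_1[symmetric] is_interval_1 I_def
      by (auto intro: le_less_trans simp flip: ereal_less_eq(3))
  qed (use r rmax t in \<open>auto simp: I_def v_def\<close>)
  have IU: "(v, s) \<in> ?U" if "s \<in> I" for s
    using that t by (auto simp: I_def v_def exterior_region_def)
  have Upos: "s > 0" if "(w, s) \<in> ?U" for w s
    using that R r0 a(2) by (fastforce simp: exterior_region_def intro: less_le_trans[OF mult_pos_pos])
  obtain Df where Df: "open Df" "D \<subseteq> Df" "\<And>k. Ck_on k Df f"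
    using f(2) unfolding smooth_on_def by blast
  obtain W1 where "smooth_mass M1 W1" and W1: "?U \<subseteq> W1"
    using smooth_mass_neighbourhood[of ?U M1] M Upos by blast
  then interpret M1: smooth_mass M1 W1 by simp
  obtain W2 where "smooth_mass M2 W2" and W2: "?U \<subseteq> W2"
    using smooth_mass_neighbourhood[of ?U M2] M Upos by blast
  then interpret M2: smooth_mass M2 W2 by simp
  have match1: "matches_flrw r0 a J \<T> \<R> M1" and match2: "matches_flrw r0 a J \<T> \<R> M2"
    using M by auto

  have O: "R_plus M (v, s) \<in> \<O>"
    if "s \<in> I" "?U \<subseteq> W" "smooth_mass M W" "M \<in> {M1, M2}" for M W s
  proof -
    define x :: event where "x = vector [v, s, pi / 2, 0]"
    have "x \<in> exterior_events ?U" "x \<in> exterior_events W"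
      using IU[OF that(1)] that(2) by (auto simp: x_def exterior_events_def)
    then show ?thesis
      using M that(4) smooth_mass.ricci_scalar_vaidya[OF that(3), of x] by (auto simp: x_def)
  qed
  have O1: "R_plus M1 (v, s) \<in> \<O>" and O2: "R_plus M2 (v, s) \<in> \<O>" if "s \<in> I" for s
    using O[OF that W1 M1.smooth_mass_axioms] O[OF that W2 M2.smooth_mass_axioms] by auto
  have D1: "R_plus M1 (v, s) \<in> Df" and D2: "R_plus M2 (v, s) \<in> Df" if "s \<in> I" for s
    using O1[OF that] O2[OF that] fR(3) Df(2) by auto

  \<comment> \<open>Data on Sigma: the Ricci scalar and its r-derivative\<close>
  obtain Wa where Wa: "J \<subseteq> Wa" "\<And>k. Ck_on k Wa a"
    using a(1) unfolding smooth_on_def by blast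
  have "((\<lambda>t. r0 * a t) has_real_derivative r0 * deriv a t) (at t)"
    by (intro DERIV_cmult Ck_on_DERIV[OF Wa(2)]) (use Wa(1) t in blast)
  then have R': "(\<R> has_real_derivative r0 * deriv a t) (at t)"
    by (rule has_field_derivative_transform_within_open[OF _ J(1) t]) (use R in auto)
  \<comment> \<open>Along Sigma, (M5) gives R_-' = T' R_v + R' R_r, with R_v and R_r the partial
    derivatives of the exterior scalar. Substituting R_v = -(1 - R') R_r from (M6) and T' = 1/(1 -
    R') from (M2) leaves R_-' = -(1 - R') R_r, whose left side is independent of
    \<open>M\<close>.\<close>
  have normal: "(1 - deriv \<R> t) * d_r (R_plus M) (v, \<R> t) = - deriv (R_minus a) t"
    if "smooth_mass M W" "?U \<subseteq> W" "matches_flrw r0 a J \<T> \<R> M" for M W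
  proof -
    have "R_plus M differentiable (at (\<T> t, \<R> t))"
      by (rule smooth_mass.differentiable_R_plus[OF that(1)]) (use IU[OF I(2)] that(2) in \<open>auto simp: v_def\<close>)
    from has_real_derivative_along_curve[OF this bspec[OF T(1) t] R']
    have "(R_minus a has_real_derivative 1 / (1 - r0 * deriv a t) * d_v (R_plus M) (\<T> t, \<R> t)
        + r0 * deriv a t * d_r (R_plus M) (\<T> t, \<R> t)) (at t)"
      by (rule has_field_derivative_transform_within_open[OF _ J(1) t])
         (use that(3) in \<open>auto simp: matches_flrw_def\<close>)
    then have "deriv (R_minus a) t = 1 / (1 - r0 * deriv a t) * d_v (R_plus M) (\<T> t, \<R> t)
        + r0 * deriv a t * d_r (R_plus M) (\<T> t, \<R> t)"
      by (rule DERIV_imp_deriv)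
    moreover have "d_v (R_plus M) (\<T> t, \<R> t) = (1 - r0 * deriv a t) * - d_r (R_plus M) (\<T> t, \<R> t)"
      using that(3) t DERIV_imp_deriv[OF R'] by (auto simp: matches_flrw_def algebra_simps)
    ultimately have "deriv (R_minus a) t =
        - d_r (R_plus M) (\<T> t, \<R> t) + r0 * deriv a t * d_r (R_plus M) (\<T> t, \<R> t)"
      using a(3) t by simp
    then show ?thesis
      using DERIV_imp_deriv[OF R'] by (simp add: v_def algebra_simps)
  qed
  \<comment> \<open>This permits cancelling the common factor 1 - R' in the two instances of
    \<open>normal\<close>.\<close>
  have "deriv \<R> t \<noteq> 1"
    using a(3) t DERIV_imp_deriv[OF R'] by simp
  then have R_r: "d_r (R_plus M1) (v, \<R> t) = d_r (R_plus M2) (v, \<R> t)"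
    using trans[OF normal[OF M1.smooth_mass_axioms W1 match1]
        normal[OF M2.smooth_mass_axioms W2 match2, symmetric]]
    unfolding mult_cancel_left by argo
  have R_eq: "R_plus M1 (v, \<R> t) = R_plus M2 (v, \<R> t)"
    using match1 match2 t by (simp add: matches_flrw_def v_def)

  \<comment> \<open>Integration along lines of constant v\<close>
  let ?H1 = "\<lambda>q. deriv f (R_plus M1 q)" and ?H2 = "\<lambda>q. deriv f (R_plus M2 q)"
  have V1: "(v, s) \<in> W1" and V2: "(v, s) \<in> W2" if "s \<in> I" for s
    using IU[OF that] W1 W2 by auto
  have H'': "d_r (d_r ?H1) (v, s) = 0" "d_r (d_r ?H2) (v, s) = 0" if "s \<in> I" for s
    using M IU[OF that] V1[OF that] V2[OF that]
    by (auto intro: M1.field_equation_rr M2.field_equation_rr)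
  have "d_r ?H1 (v, s) - d_r ?H2 (v, s) = 0" if "s \<in> I" for s
  proof (rule DERIV_zero_imp_zero[OF I(1) _ I(2) _ that])
    show "((\<lambda>s. d_r ?H1 (v, s) - d_r ?H2 (v, s)) has_real_derivative 0) (at s)" if "s \<in> I" for s
      using DERIV_diff[OF M1.DERIV_d_r_fR[OF Df(3,1) V1[OF that] D1[OF that]]
          M2.DERIV_d_r_fR[OF Df(3,1) V2[OF that] D2[OF that]]] H''[OF that] by simp
    \<comment> \<open>By the chain rule each term is f_RR(R) R_r, and both R and R_r agree on
      Sigma.\<close>
    show "d_r ?H1 (v, \<R> t) - d_r ?H2 (v, \<R> t) = 0"
      using M1.DERIV_fR(2)[OF Df(3) V1 D1 Df(1)] M2.DERIV_fR(2)[OF Df(3) V2 D2 Df(1)] I(2) R_r R_eq by simp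
  qed
  note H' = this
  have "?H1 (v, s) - ?H2 (v, s) = 0" if "s \<in> I" for s
  proof (rule DERIV_zero_imp_zero[OF I(1) _ I(2) _ that])
    show "((\<lambda>s. ?H1 (v, s) - ?H2 (v, s)) has_real_derivative 0) (at s)" if "s \<in> I" for s
      using DERIV_diff[OF M1.DERIV_fR(1)[OF Df(3) V1[OF that] D1[OF that] Df(1)]
          M2.DERIV_fR(1)[OF Df(3) V2[OF that] D2[OF that] Df(1)]] H'[OF that] by simp
    show "?H1 (v, \<R> t) - ?H2 (v, \<R> t) = 0" using R_eq by simp
  qed
  \<comment> \<open>Both scalars stay in \<open>\<O>\<close> along the slice, where equal values of
    \<open>deriv f\<close> force equal arguments.\<close>
  then have R12: "R_plus M1 (v, s) = R_plus M2 (v, s)" if "s \<in> I" for s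
    using that inj_onD[OF fR(5) _ O1 O2] by simp

  \<comment> \<open>The factor s^2 is integrating: (s^2 u)' = s (s u' + 2 u), and for u = M_r the
    bracket is s^2/2 times the Ricci scalar. The initial value vanishes by (M4).\<close>
  have "s\<^sup>2 * (d_r M1 (v, s) - d_r M2 (v, s)) = 0" if "s \<in> I" for s
  proof (rule DERIV_zero_imp_zero[OF I(1) _ I(2) _ that])
    show "((\<lambda>s. s\<^sup>2 * (d_r M1 (v, s) - d_r M2 (v, s))) has_real_derivative 0) (at s)" if "s \<in> I" for s
    proof -
      have "s > 0" using Upos IU[OF that] by blast
      have "((\<lambda>s. s\<^sup>2 * (d_r M1 (v, s) - d_r M2 (v, s))) has_real_derivative
          s * (s * d_r (d_r M1) (v, s) + 2 * d_r M1 (v, s))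
          - s * (s * d_r (d_r M2) (v, s) + 2 * d_r M2 (v, s))) (at s)"
        using M1.DERIV_iterate_d_r[OF V1[OF that], of 1] M2.DERIV_iterate_d_r[OF V2[OF that], of 1]
        by (auto intro!: derivative_eq_intros simp: algebra_simps power2_eq_square)
      moreover have "s * d_r (d_r M1) (v, s) + 2 * d_r M1 (v, s) =
          s * d_r (d_r M2) (v, s) + 2 * d_r M2 (v, s)"
        using R12[OF that] \<open>s > 0\<close> by (simp add: R_plus_def)
      ultimately show ?thesis by simp
    qed
    show "(\<R> t)\<^sup>2 * (d_r M1 (v, \<R> t) - d_r M2 (v, \<R> t)) = 0"
      using match1 match2 t by (simp add: matches_flrw_def v_def)
  qed
  then have M': "d_r M1 (v, s) = d_r M2 (v, s)" if "s \<in> I" for s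
    using that Upos IU[OF that] by fastforce
  \<comment> \<open>A last integration, started from (M3).\<close>
  have "M1 (v, r) - M2 (v, r) = 0"
  proof (rule DERIV_zero_imp_zero[OF I(1) _ I(2) _ I(3)])
    show "((\<lambda>s. M1 (v, s) - M2 (v, s)) has_real_derivative 0) (at s)" if "s \<in> I" for s
      using DERIV_diff[OF M1.DERIV_iterate_d_r[OF V1[OF that], of 0]
          M2.DERIV_iterate_d_r[OF V2[OF that], of 0]] M'[OF that] by simp
    show "M1 (v, \<R> t) - M2 (v, \<R> t) = 0"
      using bspec[OF match1[unfolded matches_flrw_def] t] bspec[OF match2[unfolded matches_flrw_def] t]
      by (simp only: v_def diff_self)
  qed
  then show "M1 q = M2 q" by (simp add: q v_def)
qed

end
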